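(* (1) If $n=3$ (three agents and three items), then every strict intensity profile has an intensity-efficient allocation. (2) For every $n\ge 4$ (four or more agents and items) this is not true in general: there exists a strict intensity profile with $n$ agents and $n$ items that has no intensity-efficient allocation.
   Context: Let $A$ be a set of $n$ items and $N=\{1,\dots,n\}$ a set of $n$ agents. The intensity relation of agent $l$ is a binary relation $\dot{\succsim}_l$ on $A\times A$ with symmetric part $\dot{\sim}_l$; its induced preference on $A$ is $a\succsim_l b \Leftrightarrow (a,b)\,\dot{\succsim}_l\,(b,a)$, with asymmetric part $\succ_l$. $\dot{\succsim}_l$ is representable by a preference intensity function if there is $s_l:A\times A\to\mathbb{R}$ such that for all $a,b,c,d,e\in A$: (i) $(a,b)\,\dot{\succsim}_l\,(c,d)\Leftrightarrow s_l(a,b)\ge s_l(c,d)$; (ii) $(a,b)\,\dot{\succsim}_l\,(b,a)\Leftrightarrow s_l(a,b)\ge s_l(e,e)\ge s_l(b,a)$; (iii) $\min\{s_l(a,b),s_l(b,c)\}\ge s_l(e,e)$ implies $s_l(a,c)\ge\max\{s_l(a,b),s_l(b,c)\}$, and a strict inequality in the hypothesis implies a strict inequality in the conclusion; (iv) (reversal) $s_l(a,b)\ge s_l(c,d)\Leftrightarrow s_l(d,c)\ge s_l(b,a)$. Strictness: $(a,b)\,\dot{\sim}_l\,(c,d)$ fails for all distinct pairs $(a,b)\neq(c,d)$ with $a\ne b$, $c\ne d$. A strict intensity profile is a tuple $(\dot{\succsim}_1,\dots,\dot{\succsim}_n)$ of representable relations satisfying Strictness; each induced preference is then a strict linear order.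 From now on $s_l$ denotes the canonical representation of $\dot{\succsim}_l$, i.e. the one with range $\{-k,\dots,-1,0,1,\dots,k\}$, $k=\binom n2$; it satisfies $s_l(a,a)=0$, $s_l(a,b)=-s_l(b,a)$ and $s_l(a,b)>0\Leftrightarrow a\succ_l b$. An allocation is a bijection $x:N\to A$, $i\mapsto x_i$. It is Pareto-efficient if no allocation $y$ satisfies $y_i\succsim_i x_i$ for all $i$ and $y_i\succ_i x_i$ for some $i$. Allocation $x$ intensity-dominates allocation $y$ if for every pair of distinct agents $(i,j)$ such that $(x_i,x_j)=(y_j,y_i)=(a,b)$ it holds that $s_i(a,b)\ge s_j(a,b)$, with strict inequality for some such pair. An allocation is intensity-efficient if it is Pareto-efficient and not intensity-dominated by another Pareto-efficient allocation. *)

theory Defs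
  imports Complex_Main "HOL-Library.FuncSet"
begin

(* ((a, b), (c, d)) \<in> R reads: a is preferred to b at least as intensely as c is preferred to d. *)
type_synonym 'a intensity = "(('a \<times> 'a) \<times> ('a \<times> 'a)) set"

definition pref :: "'a intensity \<Rightarrow> 'a \<Rightarrow> 'a \<Rightarrow> bool" where
  "pref R a b \<longleftrightarrow> ((a, b), (b, a)) \<in> R"

definition strict_pref :: "'a intensity \<Rightarrow> 'a \<Rightarrow> 'a \<Rightarrow> bool" where
  "strict_pref R a b \<longleftrightarrow> pref R a b \<and> \<not> pref R b a"

definition represents :: "'a set \<Rightarrow> 'a intensity \<Rightarrow> ('a \<times> 'a \<Rightarrow> real) \<Rightarrow> bool" where
  "represents A R s \<longleftrightarrow>
    (\<forall>a\<in>A. \<forall>b\<in>A. \<forall>c\<in>A. \<forall>d\<in>A. ((a, b), (c, d)) \<in> R \<longleftrightarrow> s (a, b) \<ge> s (c, d)) \<and>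
    (\<forall>a\<in>A. \<forall>b\<in>A. \<forall>e\<in>A.
       ((a, b), (b, a)) \<in> R \<longleftrightarrow> s (a, b) \<ge> s (e, e) \<and> s (e, e) \<ge> s (b, a)) \<and>
    (\<forall>a\<in>A. \<forall>b\<in>A. \<forall>c\<in>A. \<forall>e\<in>A.
       (min (s (a, b)) (s (b, c)) \<ge> s (e, e) \<longrightarrow> s (a, c) \<ge> max (s (a, b)) (s (b, c))) \<and>
       (min (s (a, b)) (s (b, c)) > s (e, e) \<longrightarrow> s (a, c) > max (s (a, b)) (s (b, c)))) \<and>
    (\<forall>a\<in>A. \<forall>b\<in>A. \<forall>c\<in>A. \<forall>d\<in>A. s (a, b) \<ge> s (c, d) \<longleftrightarrow> s (d, c) \<ge> s (b, a))"

definition representable :: "'a set \<Rightarrow> 'a intensity \<Rightarrow> bool" where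
  "representable A R \<longleftrightarrow> (\<exists>s. represents A R s)"

definition indifferent :: "'a intensity \<Rightarrow> 'a \<times> 'a \<Rightarrow> 'a \<times> 'a \<Rightarrow> bool" where
  "indifferent R p q \<longleftrightarrow> (p, q) \<in> R \<and> (q, p) \<in> R"

definition strictness :: "'a set \<Rightarrow> 'a intensity \<Rightarrow> bool" where
  "strictness A R \<longleftrightarrow>
    (\<forall>a\<in>A. \<forall>b\<in>A. \<forall>c\<in>A. \<forall>d\<in>A.
       (a, b) \<noteq> (c, d) \<and> a \<noteq> b \<and> c \<noteq> d \<longrightarrow> \<not> indifferent R (a, b) (c, d))"

abbreviation agents :: "'a set \<Rightarrow> nat set" where
  "agents A \<equiv> {1..card A}"

definition strict_intensity_profile :: "'a set \<Rightarrow> (nat \<Rightarrow> 'a intensity) \<Rightarrow> bool" where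
  "strict_intensity_profile A R \<longleftrightarrow>
    (\<forall>l\<in>agents A. R l \<subseteq> (A \<times> A) \<times> (A \<times> A) \<and> representable A (R l) \<and> strictness A (R l))"

definition is_canonical :: "'a set \<Rightarrow> 'a intensity \<Rightarrow> ('a \<times> 'a \<Rightarrow> real) \<Rightarrow> bool" where
  "is_canonical A R s \<longleftrightarrow>
    represents A R s \<and>
    s ` (A \<times> A) = real_of_int ` {- int (card A choose 2)..int (card A choose 2)}"

(* Extensionality fixes the values outside A \<times> A, so that the description is unique;
   see canonical_ex1 below. *)
definition canonical :: "'a set \<Rightarrow> 'a intensity \<Rightarrow> 'a \<times> 'a \<Rightarrow> real" where
  "canonical A R = (THE s. s \<in> extensional (A \<times> A) \<and> is_canonical A R s)"

definition allocation :: "'a set \<Rightarrow> (nat \<Rightarrow> 'a) \<Rightarrow> bool" where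
  "allocation A x \<longleftrightarrow> bij_betw x (agents A) A"

definition pareto_efficient :: "'a set \<Rightarrow> (nat \<Rightarrow> 'a intensity) \<Rightarrow> (nat \<Rightarrow> 'a) \<Rightarrow> bool" where
  "pareto_efficient A R x \<longleftrightarrow>
    allocation A x \<and>
    \<not> (\<exists>y. allocation A y \<and> (\<forall>i\<in>agents A. pref (R i) (y i) (x i)) \<and>
           (\<exists>i\<in>agents A. strict_pref (R i) (y i) (x i)))"

definition intensity_dominates ::
    "'a set \<Rightarrow> (nat \<Rightarrow> 'a intensity) \<Rightarrow> (nat \<Rightarrow> 'a) \<Rightarrow> (nat \<Rightarrow> 'a) \<Rightarrow> bool" where
  "intensity_dominates A R x y \<longleftrightarrow>
    (\<forall>i\<in>agents A. \<forall>j\<in>agents A. i \<noteq> j \<and> (x i, x j) = (y j, y i) \<longrightarrow>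
       canonical A (R i) (x i, x j) \<ge> canonical A (R j) (x i, x j)) \<and>
    (\<exists>i\<in>agents A. \<exists>j\<in>agents A. i \<noteq> j \<and> (x i, x j) = (y j, y i) \<and>
       canonical A (R i) (x i, x j) > canonical A (R j) (x i, x j))"

definition intensity_efficient :: "'a set \<Rightarrow> (nat \<Rightarrow> 'a intensity) \<Rightarrow> (nat \<Rightarrow> 'a) \<Rightarrow> bool" where
  "intensity_efficient A R x \<longleftrightarrow>
    pareto_efficient A R x \<and>
    \<not> (\<exists>y. pareto_efficient A R y \<and> intensity_dominates A R y x)"

lemma represents_mono:
  assumes "represents A R s"
    and f: "\<And>p q. p \<in> A \<times> A \<Longrightarrow> q \<in> A \<times> A \<Longrightarrow> t p \<le> t q \<longleftrightarrow> s p \<le> s q"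
  shows "represents A R t"
proof -
  have g: "t p < t q \<longleftrightarrow> s p < s q" if "p \<in> A \<times> A" "q \<in> A \<times> A" for p q
    using f[OF that(2,1)] by linarith
  have "represents A R t \<longleftrightarrow> represents A R s"
    unfolding represents_def by (simp add: f g cong: ball_cong)
  then show ?thesis using assms(1) by blast
qed

lemma represents_order:
  assumes "represents A R s" "represents A R t" "p \<in> A \<times> A" "q \<in> A \<times> A"
  shows "t p \<le> t q \<longleftrightarrow> s p \<le> s q"
proof -
  obtain a b c d where pq: "p = (a, b)" "q = (c, d)" by (metis surj_pair)
  have mem: "a \<in> A" "b \<in> A" "c \<in> A" "d \<in> A" using assms(3,4) pq by auto
  have "((c, d), (a, b)) \<in> R \<longleftrightarrow> s p \<le> s q"
    using assms(1) mem unfolding represents_def pq by blast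
  moreover have "((c, d), (a, b)) \<in> R \<longleftrightarrow> t p \<le> t q"
    using assms(2) mem unfolding represents_def pq by blast
  ultimately show ?thesis by blast
qed

lemma strict_mono_image_self:
  fixes h :: "real \<Rightarrow> real"
  assumes "finite V" "strict_mono_on V h" "h ` V = V" "v \<in> V"
  shows "h v = v"
proof -
  let ?xs = "sorted_list_of_set V"
  have "sorted_wrt (<) (map h ?xs)"
    unfolding sorted_wrt_map
    by (rule sorted_wrt_mono_rel[OF _ strict_sorted_list_of_set[of V]])
      (use assms in \<open>auto simp: strict_mono_on_def\<close>)
  then have "map h ?xs = ?xs"
    using assms by (intro strict_sorted_equal) auto
  then show ?thesis
    using assms(1,4) by (metis list.map_ident map_eq_conv set_sorted_list_of_set)
qed

lemma card_represents_image:
  assumes "finite A" "A \<noteq> {}" "strictness A R" "represents A R s"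
  shows "card (s ` (A \<times> A)) = 2 * (card A choose 2) + 1"
proof -
  obtain e where e: "e \<in> A" using assms(2) by blast
  define D where "D = {p \<in> A \<times> A. fst p \<noteq> snd p}"
  define E where "E = (\<lambda>a. (a, a)) ` A"
  have DE: "A \<times> A = D \<union> E" "D \<inter> E = {}"
    by (auto simp: D_def E_def)
  have fin: "finite D" "finite E"
    using assms(1) by (simp_all add: D_def E_def)
  have R: "((a, b), (c, d)) \<in> R \<longleftrightarrow> s (a, b) \<ge> s (c, d)"
    if "a \<in> A" "b \<in> A" "c \<in> A" "d \<in> A" for a b c d
    using assms(4) that unfolding represents_def by blast
  have R2: "((a, b), (b, a)) \<in> R \<longleftrightarrow> s (a, b) \<ge> s (c, c) \<and> s (c, c) \<ge> s (b, a)"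
    if "a \<in> A" "b \<in> A" "c \<in> A" for a b c
    using assms(4) that unfolding represents_def by blast
  have rev: "s (a, b) \<ge> s (c, d) \<longleftrightarrow> s (d, c) \<ge> s (b, a)"
    if "a \<in> A" "b \<in> A" "c \<in> A" "d \<in> A" for a b c d
    using assms(4) that unfolding represents_def by blast
  have diag: "s (a, a) = s (e, e)" if "a \<in> A" for a
    using R[of a a a a] R2[of a a e] that e by force
  have str: "s (a, b) \<noteq> s (c, d)"
    if "a \<in> A" "b \<in> A" "c \<in> A" "d \<in> A" "a \<noteq> b" "c \<noteq> d" "(a, b) \<noteq> (c, d)" for a b c d
  proof
    assume "s (a, b) = s (c, d)"
    then have "indifferent R (a, b) (c, d)"
      using that R by (simp add: indifferent_def)
    then show False using assms(3) that unfolding strictness_def by blast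
  qed
  have inj: "inj_on s D"
  proof (rule inj_onI)
    fix p q assume pq: "p \<in> D" "q \<in> D" "s p = s q"
    obtain a b c d where "p = (a, b)" "q = (c, d)" by (metis surj_pair)
    then show "p = q" using pq str[of a b c d] by (auto simp: D_def)
  qed
  have off: "s (a, b) \<noteq> s (e, e)" if "a \<in> A" "b \<in> A" "a \<noteq> b" for a b
    using rev[of a b e e] rev[of e e a b] str[of a b b a] that e by force
  have "s ` E = (\<lambda>a. s (e, e)) ` A"
    unfolding E_def image_image by (rule image_cong) (simp_all add: diag)
  then have sE: "s ` E = {s (e, e)}" using e by auto
  have nD: "s (e, e) \<notin> s ` D"
  proof
    assume "s (e, e) \<in> s ` D"
    then obtain a b where "(a, b) \<in> D" "s (e, e) = s (a, b)" by auto
    then show False using off[of a b] by (simp add: D_def)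
  qed
  have "card E = card A"
    unfolding E_def by (rule card_image) (simp add: inj_on_def)
  moreover have "card A * card A = card D + card E"
    using card_Un_disjoint[OF fin DE(2)] DE(1) by (metis card_cartesian_product)
  ultimately have "card D = card A * (card A - 1)"
    by (simp add: diff_mult_distrib2)
  also have "\<dots> = 2 * (card A choose 2)"
    by (cases "card A") (simp_all add: choose_two)
  finally have "card (s ` D) = 2 * (card A choose 2)"
    using inj by (simp add: card_image)
  then show ?thesis
    unfolding DE(1) image_Un sE using nD fin by simp
qed

lemma canonical_ex1:
  assumes "finite A" "A \<noteq> {}" "representable A R" "strictness A R"
  shows "\<exists>!s. s \<in> extensional (A \<times> A) \<and> is_canonical A R s"
proof -
  obtain s where s: "represents A R s" using assms(3) unfolding representable_def by blast
  define k where "k = (card A choose 2)"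
  define V where "V = s ` (A \<times> A)"
  have fV: "finite V" using assms(1) by (simp add: V_def)
  have cV: "card V = 2 * k + 1"
    using card_represents_image[OF assms(1,2,4) s] by (simp add: V_def k_def)
  define f where "f v = int (card {w \<in> V. w < v}) - int k" for v
  have less: "f v < f w" if "v \<in> V" "w \<in> V" "v < w" for v w
  proof -
    have "{u \<in> V. u < v} \<subset> {u \<in> V. u < w}" using that by fastforce
    then show ?thesis using fV by (simp add: f_def psubset_card_mono)
  qed
  have le: "f v \<le> f w \<longleftrightarrow> v \<le> w" if "v \<in> V" "w \<in> V" for v w
    using less[of v w] less[of w v] that by (cases v w rule: linorder_cases) auto
  have fsub: "f ` V \<subseteq> {- int k..int k}"
  proof
    fix z assume "z \<in> f ` V"
    then obtain v where v: "v \<in> V" "z = f v" by blast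
    have "{w \<in> V. w < v} \<subset> V" using v(1) by blast
    then have "card {w \<in> V. w < v} < card V" using fV by (rule psubset_card_mono[rotated])
    then show "z \<in> {- int k..int k}" using v cV by (simp add: f_def)
  qed
  have "inj_on f V" by (rule inj_onI) (metis le order_antisym order_refl)
  then have "card (f ` V) = card {- int k..int k}" using cV by (simp add: card_image)
  then have fV': "f ` V = {- int k..int k}" using fsub by (intro card_subset_eq) auto
  define t where "t = restrict (\<lambda>p. real_of_int (f (s p))) (A \<times> A)"
  have "represents A R t"
    by (rule represents_mono[OF s]) (use le in \<open>simp add: t_def V_def\<close>)
  moreover have "t ` (A \<times> A) = real_of_int ` {- int k..int k}"
    unfolding fV'[symmetric] V_def t_def image_image by simp
  ultimately have ex: "t \<in> extensional (A \<times> A) \<and> is_canonical A R t"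
    by (simp add: t_def is_canonical_def k_def)
  have uniq: "u = v" if u: "u \<in> extensional (A \<times> A)" "is_canonical A R u"
    and v: "v \<in> extensional (A \<times> A)" "is_canonical A R v" for u v
  proof (rule extensionalityI[OF u(1) v(1)])
    fix p assume p: "p \<in> A \<times> A"
    have ord: "u q \<le> u r \<longleftrightarrow> v q \<le> v r" if "q \<in> A \<times> A" "r \<in> A \<times> A" for q r
      using represents_order[OF _ _ that, of R v u] u(2) v(2) by (simp add: is_canonical_def)
    define W where "W = u ` (A \<times> A)"
    have Wv: "v ` (A \<times> A) = W" using u(2) v(2) by (simp add: W_def is_canonical_def)
    have fW: "finite W" using assms(1) by (simp add: W_def)
    define h where "h w = v (SOME q. q \<in> A \<times> A \<and> u q = w)" for w
    have hu: "h (u q) = v q" if "q \<in> A \<times> A" for q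
    proof -
      define r where "r = (SOME r. r \<in> A \<times> A \<and> u r = u q)"
      have r: "r \<in> A \<times> A \<and> u r = u q"
        unfolding r_def by (rule someI[of _ q]) (use that in simp)
      then have "v r = v q" using ord[of r q] ord[of q r] that by simp
      then show ?thesis by (simp add: h_def r_def)
    qed
    have "strict_mono_on W h"
    proof (rule strict_mono_onI)
      fix x y assume "x \<in> W" "y \<in> W" "x < y"
      then obtain q r where qr: "q \<in> A \<times> A" "r \<in> A \<times> A" "x = u q" "y = u r"
        unfolding W_def by blast
      then show "h x < h y" using ord[of r q] \<open>x < y\<close> hu[of q] hu[of r] by simp
    qed
    moreover have "h ` W = v ` (A \<times> A)"
      unfolding W_def image_image by (rule image_cong) (simp_all add: hu)
    ultimately have "h (u p) = u p"
      using strict_mono_image_self[OF fW, of h "u p"] Wv p by (simp add: W_def)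
    then show "u p = v p" using hu[OF p] by simp
  qed
  show ?thesis using ex uniq by (intro ex1I[of _ t]) auto
qed

lemma canonical:
  assumes "finite A" "A \<noteq> {}" "representable A R" "strictness A R"
  shows "is_canonical A R (canonical A R)"
  using theI'[OF canonical_ex1[OF assms]] unfolding canonical_def by blast

end

(* With three items the canonical scale takes the value 3 on the extreme pair and {1, 2} on the
   adjacent ones, so it is additive and comes from a utility function. Two allocations that are
   comparable by domination then differ by one swap, which raises total utility; hence a maximizer
   of total utility is intensity-efficient.

   For n >= 4 let agents 1, ..., 4 rank the items 1 > 2 > ... > n and let agent k >= 5 rank item k
   first. The Pareto-efficient allocations are exactly those giving every agent k >= 5 item k.
   Agents 2, 3, 4 share a scale which differs from that of agent 1 so that a swap improves on every
   such allocation: if agent 1 holds item 1, 2, 4, 3 it should trade for item 2, 4, 3, 1. *)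
theory Submission
  imports Defs "HOL-Combinatorics.Transposition"
begin

text \<open>Reversal makes \<open>s (a, b) \<mapsto> - s (b, a)\<close> a well-defined, strictly
  increasing map on the range \<open>W\<close> of \<open>s\<close>. As \<open>W\<close> is symmetric
  about 0, the map sends this finite set onto itself, which forces it to be the identity.\<close>

lemma canonical_antisym:
  assumes "finite A" "is_canonical A R s" "a \<in> A" "b \<in> A"
  shows "s (b, a) = - s (a, b)"
proof -
  define W where "W = s ` (A \<times> A)"
  define k where "k = int (card A choose 2)"
  have W: "W = real_of_int ` {-k..k}"
    using assms(2) by (simp add: W_def k_def is_canonical_def)
  have rev: "s (prod.swap r) \<le> s (prod.swap q) \<longleftrightarrow> s q \<le> s r"
    if "q \<in> A \<times> A" "r \<in> A \<times> A" for q r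
    using assms(2) that unfolding is_canonical_def represents_def by (auto simp: prod.swap_def)
  \<comment> \<open>\<open>SOME\<close> picks an arbitrary preimage of \<open>w\<close>;
    \<open>hs\<close> shows that the choice is harmless, since reversal carries equal values to
    equal values.\<close>
  define h where "h w = - s (prod.swap (SOME q. q \<in> A \<times> A \<and> s q = w))" for w
  have hs: "h (s q) = - s (prod.swap q)" if "q \<in> A \<times> A" for q
  proof -
    define r where "r = (SOME r. r \<in> A \<times> A \<and> s r = s q)"
    have r: "r \<in> A \<times> A \<and> s r = s q"
      unfolding r_def by (rule someI[of _ q]) (use that in simp)
    then have "s (prod.swap r) = s (prod.swap q)" using rev[of r q] rev[of q r] that by simp
    then show ?thesis by (simp add: h_def r_def)
  qed
  have mono: "strict_mono_on W h"
  proof (rule strict_mono_onI)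
    fix x y assume "x \<in> W" "y \<in> W" "x < y"
    then obtain q r where "q \<in> A \<times> A" "r \<in> A \<times> A" "x = s q" "y = s r"
      unfolding W_def by blast
    then show "h x < h y" using rev[of r q] \<open>x < y\<close> hs[of q] hs[of r] by simp
  qed
  have "h ` W = (\<lambda>q. - s (prod.swap q)) ` (A \<times> A)"
    unfolding W_def image_image by (rule image_cong) (simp_all add: hs)
  also have "\<dots> = uminus ` s ` prod.swap ` (A \<times> A)"
    by (simp add: image_image)
  also have "\<dots> = uminus ` W"
    by (simp add: product_swap W_def)
  also have "\<dots> = real_of_int ` uminus ` {-k..k}"
    unfolding W image_image by simp
  also have "\<dots> = W"
    unfolding W by (subst image_uminus_atLeastAtMost) simp
  finally have "h (s (a, b)) = s (a, b)"
    using strict_mono_image_self[OF _ mono] assms by (simp add: W_def)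
  then show ?thesis using hs[of "(a, b)"] assms(3,4) by simp
qed

subsection \<open>Three items\<close>

text \<open>Along a chain of two positive steps the step values are distinct positive integers below
  the value of the composite, which is at most 3; so they are 1 and 2, and the composite is 3. Every
  other triple of distinct items reduces to such a chain by skew-symmetry.\<close>

lemma canonical_additive:
  assumes A: "card A = 3" and s: "is_canonical A R s" and str: "strictness A R"
    and mem: "a \<in> A" "b \<in> A" "c \<in> A"
  shows "s (a, c) = s (a, b) + s (b, c)"
proof -
  have fin: "finite A" using A by (simp add: card_ge_0_finite)
  have anti: "s (y, x) = - s (x, y)" if "x \<in> A" "y \<in> A" for x y
    using canonical_antisym[OF fin s that] .
  have diag: "s (x, x) = 0" if "x \<in> A" for x
    using anti[of x x] that by simp
  have rep: "represents A R s" using s by (simp add: is_canonical_def)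
  have neq: "s (x, y) \<noteq> s (z, w)"
    if "x \<in> A" "y \<in> A" "z \<in> A" "w \<in> A" "x \<noteq> y" "z \<noteq> w" "(x, y) \<noteq> (z, w)" for x y z w
  proof
    assume eq: "s (x, y) = s (z, w)"
    have "((x, y), (z, w)) \<in> R" "((z, w), (x, y)) \<in> R"
      using rep that eq unfolding represents_def by (metis order_refl)+
    then show False using str that unfolding strictness_def indifferent_def by blast
  qed
  have int: "\<exists>m::int. s (x, y) = m \<and> m \<le> 3" if "x \<in> A" "y \<in> A" for x y
  proof -
    have "s (x, y) \<in> s ` (A \<times> A)" using that by blast
    then have "s (x, y) \<in> real_of_int ` {- int (card A choose 2)..int (card A choose 2)}"
      using s by (simp add: is_canonical_def)
    then show ?thesis using A by (auto simp: choose_two)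
  qed
  have chain: "s (x, z) = s (x, y) + s (y, z)"
    if "x \<in> A" "y \<in> A" "z \<in> A" "s (x, y) > 0" "s (y, z) > 0" for x y z
  proof -
    have "s (x, z) > max (s (x, y)) (s (y, z))"
      using rep that diag[of x] unfolding represents_def by (metis min_less_iff_conj)
    moreover have "x \<noteq> y" "y \<noteq> z" using that diag by auto
    then have "s (x, y) \<noteq> s (y, z)" using neq[of x y y z] that by auto
    moreover note int[OF that(1,2)] int[OF that(2,3)] int[OF that(1,3)]
    ultimately show ?thesis using that by auto
  qed
  show ?thesis
  proof (cases "a = b \<or> b = c \<or> a = c")
    case True
    then show ?thesis using diag[OF mem(1)] diag[OF mem(2)] anti[OF mem(1,2)] by auto
  next
    case False
    then have "s (a, b) \<noteq> s (b, a)" "s (b, c) \<noteq> s (c, b)" "s (a, c) \<noteq> s (c, a)"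
      using neq[of a b b a] neq[of b c c b] neq[of a c c a] mem by auto
    moreover note an = anti[OF mem(1,2)] anti[OF mem(2,3)] anti[OF mem(1,3)]
    ultimately have nz: "s (a, b) \<noteq> 0" "s (b, c) \<noteq> 0" "s (a, c) \<noteq> 0" by simp_all
    \<comment> \<open>One case for each ranking of \<open>a\<close>, \<open>b\<close>,
      \<open>c\<close>, given by its two adjacent comparisons; every sign pattern falls under at
      least one.\<close>
    consider "0 < s (a, b)" "0 < s (b, c)" | "0 < s (c, b)" "0 < s (b, a)"
      | "0 < s (a, c)" "0 < s (c, b)" | "0 < s (c, a)" "0 < s (a, b)"
      | "0 < s (b, a)" "0 < s (a, c)" | "0 < s (b, c)" "0 < s (c, a)"
      using nz an by linarith
    then show ?thesis
    proof cases
      case 1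
      then show ?thesis using chain[OF mem(1,2,3)] by blast
    next
      case 2
      then show ?thesis using chain[OF mem(3,2,1)] an by linarith
    next
      case 3
      then show ?thesis using chain[OF mem(1,3,2)] an by linarith
    next
      case 4
      then show ?thesis using chain[OF mem(3,1,2)] an by linarith
    next
      case 5
      then show ?thesis using chain[OF mem(2,1,3)] an by linarith
    next
      case 6
      then show ?thesis using chain[OF mem(2,3,1)] an by linarith
    qed
  qed
qed

section \<open>Maximizers of total utility\<close>

lemma finite_allocation_set: "finite A \<Longrightarrow> finite {x \<in> agents A \<rightarrow>\<^sub>E A. allocation A x}"
  by (simp add: finite_PiE)

text \<open>Allocations are functions on all of \<open>nat\<close>, so there may be infinitely many.
  Restricting them to the agents preserves total utility and leaves a finite nonempty set, on which
  a maximum is attained.\<close>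

lemma exists_welfare_maximizer:
  fixes u :: "nat \<Rightarrow> 'a \<Rightarrow> real"
  assumes "finite A"
  obtains x where "allocation A x"
    "\<And>y. allocation A y \<Longrightarrow> (\<Sum>i\<in>agents A. u i (y i)) \<le> (\<Sum>i\<in>agents A. u i (x i))"
proof -
  define X where "X = {x \<in> agents A \<rightarrow>\<^sub>E A. allocation A x}"
  define w where "w x = (\<Sum>i\<in>agents A. u i (x i))" for x
  have restr: "restrict y (agents A) \<in> X \<and> w (restrict y (agents A)) = w y"
    if "allocation A y" for y
  proof -
    have "allocation A (restrict y (agents A))"
      using that unfolding allocation_def by (subst bij_betw_cong[of _ _ y]) auto
    moreover have "y i \<in> A" if "i \<in> agents A" for i
      using that \<open>allocation A y\<close> unfolding allocation_def by (rule bij_betwE[rule_format, rotated])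
    ultimately show ?thesis by (auto simp: X_def w_def intro!: sum.cong)
  qed
  have fin: "finite X" using finite_allocation_set[OF assms] by (simp add: X_def)
  obtain y0 where "bij_betw y0 (agents A) A"
    using finite_same_card_bij[of "agents A" A] assms by auto
  then have "X \<noteq> {}" using restr by (auto simp: allocation_def)
  then have "Max (w ` X) \<in> w ` X" using fin by simp
  then obtain x where x: "x \<in> X" "Max (w ` X) = w x" by blast
  show thesis
  proof (rule that[of x])
    show "allocation A x" using x(1) by (simp add: X_def)
    show "(\<Sum>i\<in>agents A. u i (y i)) \<le> (\<Sum>i\<in>agents A. u i (x i))" if "allocation A y" for y
    proof -
      have "w (restrict y (agents A)) \<le> Max (w ` X)"
        using fin restr[OF that] by (blast intro: Max_ge)
      then have "w y \<le> w x" using restr[OF that] x(2) by argo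
      then show ?thesis by (simp only: w_def)
    qed
  qed
qed

lemma intensity_efficient_if_card_3:
  assumes A: "card A = 3" and R: "strict_intensity_profile A R"
  shows "\<exists>x. intensity_efficient A R x"
proof -
  have fin: "finite A" "A \<noteq> {}" using A by (auto simp: card_ge_0_finite)
  obtain e where e: "e \<in> A" using fin by blast
  define s where "s l = canonical A (R l)" for l
  \<comment> \<open>Measuring every item against a fixed reference item \<open>e\<close> turns the
    additive scale into a utility.\<close>
  define u where "u l a = s l (a, e)" for l a
  have can: "is_canonical A (R l) (s l)" if "l \<in> agents A" for l
    using R that fin unfolding s_def strict_intensity_profile_def by (intro canonical) auto
  have su: "s l (a, b) = u l a - u l b" if "l \<in> agents A" "a \<in> A" "b \<in> A" for l a b
  proof -
    have "s l (a, b) = s l (a, e) + s l (e, b)"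
      using canonical_additive[OF A can] R that e unfolding strict_intensity_profile_def by blast
    also have "s l (e, b) = - s l (b, e)"
      using canonical_antisym[OF fin(1) can] that e by blast
    finally show ?thesis by (simp add: u_def)
  qed
  have pref: "pref (R l) a b \<longleftrightarrow> u l b \<le> u l a" if "l \<in> agents A" "a \<in> A" "b \<in> A" for l a b
  proof -
    have "pref (R l) a b \<longleftrightarrow> s l (b, a) \<le> s l (a, b)"
      using can[OF that(1)] that unfolding pref_def is_canonical_def represents_def by blast
    then show ?thesis using su that by auto
  qed
  obtain x where x: "allocation A x"
    and max: "\<And>y. allocation A y \<Longrightarrow> (\<Sum>i\<in>agents A. u i (y i)) \<le> (\<Sum>i\<in>agents A. u i (x i))"
    using exists_welfare_maximizer[OF fin(1), of u] by blast
  have inA: "y i \<in> A" if "allocation A y" "i \<in> agents A" for y i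
    using that unfolding allocation_def by (auto dest: bij_betwE)
  have "pareto_efficient A R x"
    unfolding pareto_efficient_def
  proof (intro conjI notI; (elim exE conjE)?)
    fix y assume y: "allocation A y" "\<forall>i\<in>agents A. pref (R i) (y i) (x i)"
      "\<exists>i\<in>agents A. strict_pref (R i) (y i) (x i)"
    have "(\<Sum>i\<in>agents A. u i (x i)) < (\<Sum>i\<in>agents A. u i (y i))"
    proof (rule sum_strict_mono_ex1)
      show "\<forall>i\<in>agents A. u i (x i) \<le> u i (y i)"
        using y pref inA x by blast
      show "\<exists>i\<in>agents A. u i (x i) < u i (y i)"
        using y pref inA x unfolding strict_pref_def by (meson not_le)
    qed simp
    then show False using max[OF y(1)] by simp
  qed (rule x)
  moreover have False if y: "allocation A y" and dom: "intensity_dominates A R y x" for y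
  proof -
    obtain i j where ij: "i \<in> agents A" "j \<in> agents A" "i \<noteq> j" "y i = x j" "y j = x i"
      "s i (y i, y j) > s j (y i, y j)"
      using dom unfolding intensity_dominates_def s_def by auto
    \<comment> \<open>Only one agent stands outside the swap of \<open>i\<close> and
      \<open>j\<close>, so it must keep its item and total utility changes through \<open>i\<close>
      and \<open>j\<close> alone.\<close>
    have "card (agents A - {i, j}) = 1" using ij A by (simp add: card_Diff_subset)
    then obtain k where k: "agents A - {i, j} = {k}" by (rule card_1_singletonE)
    then have ag: "agents A = {i, j, k}" "k \<noteq> i" "k \<noteq> j" "k \<in> agents A"
      using ij(1,2) by blast+
    have "x ` {i, j, k} = A" "y ` {i, j, k} = A" and inj: "inj_on y {i, j, k}"
      using x y unfolding allocation_def bij_betw_def ag(1)[symmetric] by simp_all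
    then have "y k \<in> {x i, x j, x k}" by blast
    moreover have "y k \<noteq> y i" "y k \<noteq> y j"
      using inj_on_eq_iff[OF inj] ag(2,3) by blast+
    ultimately have yk: "y k = x k" using ij(4,5) by auto
    have xA: "x i \<in> A" "x j \<in> A" using inA[OF x] ij by auto
    have sum: "(\<Sum>l\<in>agents A. f l) = f i + f j + f k" for f :: "nat \<Rightarrow> real"
      unfolding ag(1) using ij(3) ag(2,3) by auto
    \<comment> \<open>Domination says that \<open>i\<close> gains more from the swap than
      \<open>j\<close> loses, so \<open>y\<close> would beat the maximum.\<close>
    have "u i (x j) - u i (x i) > u j (x j) - u j (x i)"
      using ij su xA by simp
    then show False using max[OF y] unfolding sum yk using ij by simp
  qed
  ultimately show ?thesis
    unfolding intensity_efficient_def pareto_efficient_def by blast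
qed

subsection \<open>Intensity relations from scales on index pairs\<close>

definition index_pairs :: "nat \<Rightarrow> (nat \<times> nat) set" where
  "index_pairs n = {(i, j). 1 \<le> i \<and> i < j \<and> j \<le> n}"

text \<open>The positive half of a canonical scale, indexed by ranks with 1 for the best item.
  Monotonicity yields the transitivity condition of \<open>represents\<close>; the bijection yields
  strictness and the canonical range.\<close>

definition gap_scale :: "nat \<Rightarrow> (nat \<Rightarrow> nat \<Rightarrow> nat) \<Rightarrow> bool" where
  "gap_scale n v \<longleftrightarrow>
    (\<forall>i j k. 1 \<le> i \<and> i < j \<and> j < k \<and> k \<le> n \<longrightarrow> v i j < v i k \<and> v j k < v i k) \<and>
    bij_betw (\<lambda>(i, j). v i j) (index_pairs n) {1..n choose 2}"

definition signed_gap :: "(nat \<Rightarrow> nat \<Rightarrow> nat) \<Rightarrow> nat \<Rightarrow> nat \<Rightarrow> real" where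
  "signed_gap v i j = (if i < j then real (v i j) else if j < i then - real (v j i) else 0)"

text \<open>Here \<open>p\<close> assigns ranks, so smaller values are better and the gap of
  \<open>(a, b)\<close> is positive when \<open>p a < p b\<close>.\<close>

definition gap_relation :: "'a set \<Rightarrow> ('a \<Rightarrow> nat) \<Rightarrow> (nat \<Rightarrow> nat \<Rightarrow> nat) \<Rightarrow> 'a intensity" where
  "gap_relation A p v =
    {((a, b), (c, d)) | a b c d. a \<in> A \<and> b \<in> A \<and> c \<in> A \<and> d \<in> A \<and>
      signed_gap v (p c) (p d) \<le> signed_gap v (p a) (p b)}"

lemma signed_gap_antisym: "signed_gap v j i = - signed_gap v i j"
  by (simp add: signed_gap_def)

lemma gap_scale_mono:
  assumes "gap_scale n v" "1 \<le> i" "i < j" "j < k" "k \<le> n"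
  shows "v i j < v i k" "v j k < v i k"
  using assms unfolding gap_scale_def by auto

lemma gap_scale_range:
  assumes "gap_scale n v" "1 \<le> i" "i < j" "j \<le> n"
  shows "1 \<le> v i j" "v i j \<le> n choose 2"
proof -
  have "(i, j) \<in> index_pairs n" using assms by (simp add: index_pairs_def)
  then have "v i j \<in> {1..n choose 2}"
    using assms(1) bij_betwE unfolding gap_scale_def by fastforce
  then show "1 \<le> v i j" "v i j \<le> n choose 2" by auto
qed

lemma gap_scale_surj:
  assumes "gap_scale n v" "1 \<le> m" "m \<le> n choose 2"
  obtains i j where "1 \<le> i" "i < j" "j \<le> n" "v i j = m"
proof -
  have "m \<in> (\<lambda>(i, j). v i j) ` index_pairs n"
    using assms unfolding gap_scale_def bij_betw_def by auto
  then show thesis using that by (auto simp: index_pairs_def)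
qed

lemma gap_scale_inj:
  assumes "gap_scale n v" "v i j = v k l"
    "1 \<le> i" "i < j" "j \<le> n" "1 \<le> k" "k < l" "l \<le> n"
  shows "i = k" "j = l"
proof -
  have "(i, j) = (k, l)"
    by (rule inj_onD[of "\<lambda>(i, j). v i j" "index_pairs n"])
      (use assms in \<open>auto simp: gap_scale_def bij_betw_def index_pairs_def\<close>)
  then show "i = k" "j = l" by auto
qed

context
  fixes A :: "'a set" and p :: "'a \<Rightarrow> nat" and v :: "nat \<Rightarrow> nat \<Rightarrow> nat" and n :: nat
  assumes p: "bij_betw p A {1..n}" and v: "gap_scale n v" and n: "0 < n"
begin

private lemma p_range: "a \<in> A \<Longrightarrow> 1 \<le> p a \<and> p a \<le> n"
  using p bij_betwE by fastforce

private lemma p_eq: "a \<in> A \<Longrightarrow> b \<in> A \<Longrightarrow> p a = p b \<longleftrightarrow> a = b"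
  using p unfolding bij_betw_def inj_on_def by blast

private lemma card_A: "card A = n"
  using bij_betw_same_card[OF p] by simp

lemma signed_gap_pos: "a \<in> A \<Longrightarrow> b \<in> A \<Longrightarrow> 0 < signed_gap v (p a) (p b) \<longleftrightarrow> p a < p b"
  using gap_scale_range[OF v, of "p a" "p b"] p_range[of a] p_range[of b]
  by (auto simp: signed_gap_def)

lemma signed_gap_nonneg: "a \<in> A \<Longrightarrow> b \<in> A \<Longrightarrow> 0 \<le> signed_gap v (p a) (p b) \<longleftrightarrow> p a \<le> p b"
  using signed_gap_pos[of b a] signed_gap_antisym[of v "p a" "p b"] by auto

private lemma signed_gap_trans:
  assumes "a \<in> A" "b \<in> A" "c \<in> A"
    "0 < signed_gap v (p a) (p b)" "0 < signed_gap v (p b) (p c)"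
  shows "signed_gap v (p a) (p b) < signed_gap v (p a) (p c)"
    "signed_gap v (p b) (p c) < signed_gap v (p a) (p c)"
proof -
  have "p a < p b" "p b < p c" using assms signed_gap_pos by auto
  then show "signed_gap v (p a) (p b) < signed_gap v (p a) (p c)"
    "signed_gap v (p b) (p c) < signed_gap v (p a) (p c)"
    using gap_scale_mono[OF v, of "p a" "p b" "p c"] p_range assms(1-3)
    by (auto simp: signed_gap_def)
qed

lemma represents_gap_relation:
  "represents A (gap_relation A p v) (\<lambda>(a, b). signed_gap v (p a) (p b))"
proof -
  \<comment> \<open>A zero gap means equal ranks, where the claim is immediate; otherwise both gaps
    are positive and the strict version applies.\<close>
  have weak: "signed_gap v (p a) (p b) \<le> signed_gap v (p a) (p c) \<and>
      signed_gap v (p b) (p c) \<le> signed_gap v (p a) (p c)"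
    if "a \<in> A" "b \<in> A" "c \<in> A"
      "0 \<le> signed_gap v (p a) (p b)" "0 \<le> signed_gap v (p b) (p c)" for a b c
  proof -
    have le: "p a \<le> p b" "p b \<le> p c" using that signed_gap_nonneg by auto
    show ?thesis
    proof (cases "p a = p b \<or> p b = p c")
      case True
      then show ?thesis using that by (auto simp: signed_gap_def)
    next
      case False
      then show ?thesis
        using signed_gap_trans[of a b c] signed_gap_pos that le by force
    qed
  qed
  show ?thesis
    unfolding represents_def
  proof (intro conjI ballI)
    fix a b e assume "a \<in> A" "b \<in> A" "e \<in> A"
    then show "((a, b), (b, a)) \<in> gap_relation A p v \<longleftrightarrow>
        (case (a, b) of (a, b) \<Rightarrow> signed_gap v (p a) (p b))
          \<ge> (case (e, e) of (a, b) \<Rightarrow> signed_gap v (p a) (p b)) \<and>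
        (case (e, e) of (a, b) \<Rightarrow> signed_gap v (p a) (p b))
          \<ge> (case (b, a) of (a, b) \<Rightarrow> signed_gap v (p a) (p b))"
      using signed_gap_antisym[of v "p a" "p b"] signed_gap_antisym[of v "p e" "p e"]
      by (simp add: gap_relation_def)
  next
    fix a b c d
    show "(case (a, b) of (a, b) \<Rightarrow> signed_gap v (p a) (p b))
          \<ge> (case (c, d) of (a, b) \<Rightarrow> signed_gap v (p a) (p b)) \<longleftrightarrow>
        (case (d, c) of (a, b) \<Rightarrow> signed_gap v (p a) (p b))
          \<ge> (case (b, a) of (a, b) \<Rightarrow> signed_gap v (p a) (p b))"
      using signed_gap_antisym[of v "p a" "p b"] signed_gap_antisym[of v "p c" "p d"] by simp
  qed (use weak signed_gap_trans in \<open>auto simp: gap_relation_def signed_gap_def[of v "p e" "p e" for e]\<close>)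
qed

lemma strictness_gap_relation: "strictness A (gap_relation A p v)"
  unfolding strictness_def
proof (intro ballI impI notI)
  fix a b c d
  assume mem: "a \<in> A" "b \<in> A" "c \<in> A" "d \<in> A"
    and ne: "(a, b) \<noteq> (c, d) \<and> a \<noteq> b \<and> c \<noteq> d"
    and ind: "indifferent (gap_relation A p v) (a, b) (c, d)"
  have eq: "signed_gap v (p a) (p b) = signed_gap v (p c) (p d)"
    using ind by (auto simp: indifferent_def gap_relation_def)
  note range = p_range[OF mem(1)] p_range[OF mem(2)] p_range[OF mem(3)] p_range[OF mem(4)]
  have np: "p a \<noteq> p b" "p c \<noteq> p d" using ne mem p_eq by auto
  have "p a = p c \<and> p b = p d"
  proof (cases "p a < p b")
    case True
    then have "p c < p d" using eq signed_gap_pos mem by metis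
    then show ?thesis
      using eq True gap_scale_inj[OF v, of "p a" "p b" "p c" "p d"] range
      by (auto simp: signed_gap_def)
  next
    case False
    then have "\<not> p c < p d" using eq signed_gap_pos mem by metis
    then show ?thesis
      using eq False np gap_scale_inj[OF v, of "p b" "p a" "p d" "p c"] range
      by (auto simp: signed_gap_def)
  qed
  then show False using p_eq mem ne by auto
qed

lemma is_canonical_gap_relation:
  "is_canonical A (gap_relation A p v) (\<lambda>(a, b). signed_gap v (p a) (p b))"
  unfolding is_canonical_def card_A
proof (intro conjI represents_gap_relation set_eqI iffI)
  fix r assume "r \<in> (\<lambda>(a, b). signed_gap v (p a) (p b)) ` (A \<times> A)"
  then obtain a b where ab: "a \<in> A" "b \<in> A" "r = signed_gap v (p a) (p b)" by auto
  define m where "m = (if p a < p b then int (v (p a) (p b))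
    else if p b < p a then - int (v (p b) (p a)) else 0)"
  have "r = real_of_int m" using ab by (simp add: m_def signed_gap_def)
  moreover have "m \<in> {- int (n choose 2)..int (n choose 2)}"
    using gap_scale_range[OF v, of "p a" "p b"] gap_scale_range[OF v, of "p b" "p a"]
      p_range[of a] p_range[of b] ab by (auto simp: m_def)
  ultimately show "r \<in> real_of_int ` {- int (n choose 2)..int (n choose 2)}" by blast
next
  fix r assume "r \<in> real_of_int ` {- int (n choose 2)..int (n choose 2)}"
  then obtain m where m: "r = real_of_int m" "- int (n choose 2) \<le> m" "m \<le> int (n choose 2)"
    by auto
  have idx: "\<exists>a\<in>A. p a = i" if "1 \<le> i" "i \<le> n" for i
    using p that unfolding bij_betw_def by (metis atLeastAtMost_iff imageE)
  show "r \<in> (\<lambda>(a, b). signed_gap v (p a) (p b)) ` (A \<times> A)"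
  proof (cases "m = 0")
    case True
    \<comment> \<open>The value 0 is attained on the diagonal, which is nonempty because
      \<open>0 < n\<close>.\<close>
    obtain a where "a \<in> A" using idx[of 1] n by auto
    then show ?thesis using True m by (force simp: signed_gap_def)
  next
    case False
    then have "1 \<le> nat \<bar>m\<bar>" "nat \<bar>m\<bar> \<le> n choose 2" using m by auto
    then obtain i j where ij: "1 \<le> i" "i < j" "j \<le> n" "v i j = nat \<bar>m\<bar>"
      using gap_scale_surj[OF v] by metis
    obtain a b where ab: "a \<in> A" "b \<in> A" "p a = i" "p b = j"
      using idx[of i] idx[of j] ij by auto
    show ?thesis
    proof (cases "m > 0")
      case True
      then have "r = signed_gap v (p a) (p b)" using ab ij m by (simp add: signed_gap_def)
      then show ?thesis using ab by force
    next
      case False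
      then have "r = signed_gap v (p b) (p a)" using ab ij m by (simp add: signed_gap_def)
      then show ?thesis using ab by force
    qed
  qed
qed

text \<open>\<open>canonical\<close> describes an extensional function, so the explicit scale is
  first restricted to \<open>A \<times> A\<close>; uniqueness then identifies the two.\<close>

lemma canonical_gap_relation:
  assumes "a \<in> A" "b \<in> A"
  shows "canonical A (gap_relation A p v) (a, b) = signed_gap v (p a) (p b)"
proof -
  let ?s = "\<lambda>(a, b). signed_gap v (p a) (p b)"
  let ?t = "restrict ?s (A \<times> A)"
  have fin: "finite A" "A \<noteq> {}" using assms bij_betw_finite[OF p] by auto
  have "represents A (gap_relation A p v) ?t"
    by (rule represents_mono[OF represents_gap_relation]) auto
  then have "?t \<in> extensional (A \<times> A) \<and> is_canonical A (gap_relation A p v) ?t"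
    using is_canonical_gap_relation unfolding is_canonical_def by (simp add: image_restrict_eq)
  then have "canonical A (gap_relation A p v) = ?t"
    unfolding canonical_def
    using canonical_ex1[OF fin _ strictness_gap_relation] represents_gap_relation
    by (intro the1_equality) (auto simp: representable_def)
  then show ?thesis using assms by simp
qed

lemma pref_gap_relation:
  assumes "a \<in> A" "b \<in> A"
  shows "pref (gap_relation A p v) a b \<longleftrightarrow> p a \<le> p b"
proof -
  have "pref (gap_relation A p v) a b \<longleftrightarrow> 0 \<le> signed_gap v (p a) (p b)"
    using assms signed_gap_antisym[of v "p a" "p b"] by (auto simp: pref_def gap_relation_def)
  then show ?thesis using signed_gap_nonneg assms by simp
qed

end

text \<open>A new worst item is added. Its \<open>n\<close> gaps fill the block of values just above
  the old range, with larger values for better partners, so monotonicity survives and the block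
  completes the range by Pascal's rule.\<close>

lemma gap_scale_Suc:
  assumes v: "gap_scale n v"
    and new: "\<And>i. 1 \<le> i \<Longrightarrow> i \<le> n \<Longrightarrow> v i (Suc n) = (n choose 2) + (Suc n - i)"
  shows "gap_scale (Suc n) v"
  unfolding gap_scale_def
proof (intro conjI allI impI)
  fix i j k assume ijk: "1 \<le> i \<and> i < j \<and> j < k \<and> k \<le> Suc n"
  have "v i j < v i k \<and> v j k < v i k"
  proof (cases "k = Suc n")
    case True
    then show ?thesis using ijk new[of i] new[of j] gap_scale_range[OF v, of i j] by auto
  next
    case False
    then show ?thesis using ijk gap_scale_mono[OF v, of i j k] by simp
  qed
  then show "v i j < v i k" "v j k < v i k" by auto
next
  let ?f = "\<lambda>(i, j). v i j"
  let ?N = "{1..n} \<times> {Suc n}"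
  have "bij_betw ?f ?N {(n choose 2) + 1..(n choose 2) + n}"
  \<comment> \<open>The witness solves \<open>m = (n choose 2) + (Suc n - i)\<close> for
    \<open>i\<close>.\<close>
  proof (rule bij_betw_byWitness[where f' = "\<lambda>m. ((n choose 2) + Suc n - m, Suc n)"])
    show "?f ` ?N \<subseteq> {(n choose 2) + 1..(n choose 2) + n}" using new by auto
    show "(\<lambda>m. ((n choose 2) + Suc n - m, Suc n)) ` {(n choose 2) + 1..(n choose 2) + n} \<subseteq> ?N"
      by auto
  qed (use new in auto)
  moreover have "bij_betw ?f (index_pairs n) {1..n choose 2}"
    using v by (simp add: gap_scale_def)
  ultimately have "bij_betw ?f (index_pairs n \<union> ?N)
      ({1..n choose 2} \<union> {(n choose 2) + 1..(n choose 2) + n})"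
    by (intro bij_betw_combine) auto
  moreover have "index_pairs n \<union> ?N = index_pairs (Suc n)"
    by (auto simp: index_pairs_def le_Suc_eq)
  moreover have "{1..n choose 2} \<union> {(n choose 2) + 1..(n choose 2) + n} = {1..Suc n choose 2}"
    by (auto simp: numeral_2_eq_2)
  ultimately show "bij_betw ?f (index_pairs (Suc n)) {1..Suc n choose 2}" by simp
qed

subsection \<open>A profile without intensity-efficient allocations\<close>

text \<open>Indices \<open>i < j\<close> stand for the items ranked \<open>i\<close>-th and \<open>j\<close>-th. From \<open>j = 5\<close> on the values only
  have to exhaust the range above \<open>6 = 4 choose 2\<close>. On \<open>{1..4}\<close> the two scales compare as
  \<open>1 < 3\<close> at \<open>(1, 2)\<close>, \<open>4 < 5\<close> at \<open>(2, 4)\<close>, \<open>3 > 1\<close> at \<open>(3, 4)\<close> and \<open>5 > 4\<close> at \<open>(1, 3)\<close>, which produces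
  the cycle \<open>1 \<rightarrow> 2 \<rightarrow> 4 \<rightarrow> 3 \<rightarrow> 1\<close> of improving swaps.\<close>

definition rising_scale :: "nat \<Rightarrow> nat \<Rightarrow> nat" where
  "rising_scale i j =
    (if 5 \<le> j then (j - 1 choose 2) + (j - i)
     else if j = i + 1 then i else if j = i + 2 then 6 - i else 6)"

definition falling_scale :: "nat \<Rightarrow> nat \<Rightarrow> nat" where
  "falling_scale i j =
    (if 5 \<le> j then (j - 1 choose 2) + (j - i)
     else if j = i + 1 then 4 - i else if j = i + 2 then 3 + i else 6)"

section \<open>Validity of the two scales\<close>

lemma index_pairs_4: "index_pairs 4 = {(1, 2), (1, 3), (1, 4), (2, 3), (2, 4), (3, 4)}"
  by (auto simp: index_pairs_def)

lemma gap_scale_4I: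
  assumes "v 1 4 = 6" "v 1 3 < 6" "v 2 4 < 6"
    "v 1 2 < v 1 3" "v 2 3 < v 1 3" "v 2 3 < v 2 4" "v 3 4 < v 2 4"
    and img: "{v 1 2, v 2 3, v 3 4, v 1 3, v 2 4} = {1..5}"
  shows "gap_scale 4 v"
  unfolding gap_scale_def
proof (intro conjI allI impI)
  fix i j k :: nat assume "1 \<le> i \<and> i < j \<and> j < k \<and> k \<le> 4"
  then have "(i, j, k) \<in> {(1, 2, 3), (1, 2, 4), (1, 3, 4), (2, 3, 4)}" by auto
  then show "v i j < v i k" "v j k < v i k" using assms by auto
next
  have c: "(4::nat) choose 2 = 6" by (simp add: choose_two)
  have "(\<lambda>(i, j). v i j) ` index_pairs 4 = insert 6 {v 1 2, v 2 3, v 3 4, v 1 3, v 2 4}"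
    using assms(1) unfolding index_pairs_4 by auto
  also have "\<dots> = {1..4 choose 2}" unfolding img c by auto
  finally have *: "(\<lambda>(i, j). v i j) ` index_pairs 4 = {1..4 choose 2}" .
  \<comment> \<open>Six pairs have six values, so surjectivity gives injectivity by
    counting.\<close>
  moreover have "inj_on (\<lambda>(i, j). v i j) (index_pairs 4)"
    by (rule eq_card_imp_inj_on) (simp_all only: *, simp_all add: index_pairs_4 c)
  ultimately show "bij_betw (\<lambda>(i, j). v i j) (index_pairs 4) {1..4 choose 2}"
    by (simp add: bij_betw_def)
qed

text \<open>From \<open>j = 5\<close> on, the scale follows the formula required by
  \<open>gap_scale_Suc\<close>, so only four items have to be checked by hand.\<close>

lemma gap_scale_rising: "4 \<le> n \<Longrightarrow> gap_scale n rising_scale"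
proof (induction n rule: dec_induct)
  case base
  show ?case by (rule gap_scale_4I) (auto simp: rising_scale_def)
qed (rule gap_scale_Suc, auto simp: rising_scale_def)

lemma gap_scale_falling: "4 \<le> n \<Longrightarrow> gap_scale n falling_scale"
proof (induction n rule: dec_induct)
  case base
  show ?case by (rule gap_scale_4I) (auto simp: falling_scale_def)
qed (rule gap_scale_Suc, auto simp: falling_scale_def)

text \<open>Moving item \<open>k\<close> to the front leaves the items behind it in place. Hence,
  for \<open>k < m\<close>, agent \<open>k\<close> ranks every item of index below \<open>m\<close>
  above item \<open>m\<close>, which drives \<open>pareto_efficient_fixes\<close>.\<close>

definition position :: "nat \<Rightarrow> nat \<Rightarrow> nat" where
  "position k j = (if k \<le> 4 then j else if j = k then 1 else if j < k then Suc j else j)"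

lemma bij_betw_position:
  assumes "k \<le> n"
  shows "bij_betw (position k) {1..n} {1..n}"
proof -
  have "i = j" if "1 \<le> i" "1 \<le> j" "position k i = position k j" for i j
    using that by (cases "i < k"; cases "j < k") (auto simp: position_def split: if_splits)
  then have "inj_on (position k) {1..n}"
    by (simp add: inj_on_def)
  moreover have "position k i \<in> {1..n}" if "i \<in> {1..n}" for i
    using that assms by (auto simp: position_def)
  ultimately show ?thesis
    unfolding bij_betw_def by (intro conjI endo_inj_surj) auto
qed

lemma allocation_transpose:
  assumes "allocation A x" "i \<in> agents A" "j \<in> agents A"
  shows "allocation A (x \<circ> transpose i j)"
  unfolding allocation_def
  by (rule bij_betw_trans[of _ _ "agents A"]) (use assms in \<open>auto simp: allocation_def\<close>)

definition agent_scale :: "nat \<Rightarrow> nat \<Rightarrow> nat \<Rightarrow> nat" where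
  "agent_scale k = (if k = 1 then rising_scale else falling_scale)"

definition cyclic_profile :: "'a set \<Rightarrow> ('a \<Rightarrow> nat) \<Rightarrow> nat \<Rightarrow> 'a intensity" where
  "cyclic_profile A h k = gap_relation A (\<lambda>a. position k (h a)) (agent_scale k)"

context
  fixes A :: "'a set" and h :: "'a \<Rightarrow> nat" and n :: nat
  assumes h: "bij_betw h A {1..n}" and n: "4 \<le> n"
begin

private lemma n_pos: "0 < n"
  using n by simp

private lemma agents_A: "agents A = {1..n}"
  using bij_betw_same_card[OF h] by simp

private lemma h_eq: "a \<in> A \<Longrightarrow> b \<in> A \<Longrightarrow> h a = h b \<longleftrightarrow> a = b"
  using h unfolding bij_betw_def inj_on_def by blast

private lemma bij_position: "k \<le> n \<Longrightarrow> bij_betw (\<lambda>a. position k (h a)) A {1..n}"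
  using bij_betw_trans[OF h bij_betw_position] by (simp add: comp_def)

private lemma agent_scale: "gap_scale n (agent_scale k)"
  using gap_scale_rising[OF n] gap_scale_falling[OF n] by (simp add: agent_scale_def)

lemma strict_intensity_profile_cyclic: "strict_intensity_profile A (cyclic_profile A h)"
  unfolding strict_intensity_profile_def
proof (intro ballI conjI)
  fix k assume "k \<in> agents A"
  then have "k \<le> n" by (simp add: agents_A del: One_nat_def)
  note * = bij_position[OF this] agent_scale n_pos
  show "cyclic_profile A h k \<subseteq> (A \<times> A) \<times> (A \<times> A)"
    by (auto simp: cyclic_profile_def gap_relation_def)
  show "representable A (cyclic_profile A h k)"
    unfolding representable_def cyclic_profile_def using represents_gap_relation[OF *] by blast
  show "strictness A (cyclic_profile A h k)"
    unfolding cyclic_profile_def using strictness_gap_relation[OF *] .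
qed

private lemma pref_cyclic:
  assumes "k \<le> n" "a \<in> A" "b \<in> A"
  shows "pref (cyclic_profile A h k) a b \<longleftrightarrow> position k (h a) \<le> position k (h b)"
  unfolding cyclic_profile_def
  by (rule pref_gap_relation[OF bij_position agent_scale n_pos]) (fact assms)+

private lemma strict_pref_cyclic:
  assumes "k \<le> n" "a \<in> A" "b \<in> A"
  shows "strict_pref (cyclic_profile A h k) a b \<longleftrightarrow> position k (h a) < position k (h b)"
  using pref_cyclic assms by (auto simp: strict_pref_def)

private lemma canonical_cyclic:
  assumes "k \<le> 4" "a \<in> A" "b \<in> A"
  shows "canonical A (cyclic_profile A h k) (a, b) = signed_gap (agent_scale k) (h a) (h b)"
proof -
  have "k \<le> n" using assms n by simp
  from canonical_gap_relation[OF bij_position[OF this] agent_scale n_pos assms(2,3)]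
  show ?thesis using assms(1) by (simp add: cyclic_profile_def position_def)
qed

section \<open>Pareto-efficient allocations of the cyclic profile\<close>

private lemma allocation_props:
  assumes "allocation A x"
  shows "i \<in> {1..n} \<Longrightarrow> x i \<in> A"
    and "i \<in> {1..n} \<Longrightarrow> h (x i) \<in> {1..n}"
    and "i \<in> {1..n} \<Longrightarrow> j \<in> {1..n} \<Longrightarrow> h (x i) = h (x j) \<Longrightarrow> i = j"
    and "m \<in> {1..n} \<Longrightarrow> \<exists>i\<in>{1..n}. h (x i) = m"
    and "(\<Sum>i\<in>{1..n}. h (x i)) = \<Sum>{1..n}"
proof -
  have x: "bij_betw x {1..n} A" using assms unfolding allocation_def agents_A .
  have hx: "bij_betw (\<lambda>i. h (x i)) {1..n} {1..n}"
    using bij_betw_trans[OF x h] by (simp add: comp_def)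
  show "i \<in> {1..n} \<Longrightarrow> x i \<in> A" using bij_betwE[OF x] by blast
  show "i \<in> {1..n} \<Longrightarrow> h (x i) \<in> {1..n}" using bij_betwE[OF hx] by blast
  show "i \<in> {1..n} \<Longrightarrow> j \<in> {1..n} \<Longrightarrow> h (x i) = h (x j) \<Longrightarrow> i = j"
    using hx unfolding bij_betw_def inj_on_def by blast
  show "m \<in> {1..n} \<Longrightarrow> \<exists>i\<in>{1..n}. h (x i) = m"
    using hx unfolding bij_betw_def by (metis imageE)
  show "(\<Sum>i\<in>{1..n}. h (x i)) = \<Sum>{1..n}"
    using sum.reindex_bij_betw[OF hx, of "\<lambda>i. i"] .
qed

text \<open>Downward induction on \<open>k\<close>. If agent \<open>k\<close> does not hold item
  \<open>k\<close>, then, since later agents hold their own items, item \<open>k\<close> is with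
  some \<open>j < k\<close> and agent \<open>k\<close> holds some item \<open>m < k\<close>.
  Swapping gives \<open>k\<close> its favourite and improves \<open>j\<close> as well.\<close>

private lemma pareto_efficient_fixes:
  assumes x: "pareto_efficient A (cyclic_profile A h) x"
  shows "5 \<le> k \<Longrightarrow> k \<le> n \<Longrightarrow> h (x k) = k"
proof (induction "n - k" arbitrary: k rule: less_induct)
  case less
  have al: "allocation A x" using x by (simp add: pareto_efficient_def)
  note props = allocation_props[OF al]
  have IH: "h (x m) = m" if "k < m" "m \<le> n" for m
    using that less by (intro less.hyps) auto
  show ?case
  proof (rule ccontr)
    assume ne: "h (x k) \<noteq> k"
    define m where "m = h (x k)"
    have k: "k \<in> {1..n}" using less by simp
    obtain j where j: "j \<in> {1..n}" "h (x j) = k" using props(4)[OF k] by blast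
    have jk: "j < k" using IH[of j] j ne by (cases j k rule: linorder_cases) auto
    have m: "m \<in> {1..n}" "m < k"
    proof -
      show "m \<in> {1..n}" using props(2)[OF k] by (simp add: m_def)
      then show "m < k"
        using IH[of m] ne k props(3)[of m k] by (cases m k rule: linorder_cases) (auto simp: m_def)
    qed
    define y where "y = x \<circ> transpose j k"
    have y: "y j = x k" "y k = x j" "\<And>i. i \<noteq> j \<Longrightarrow> i \<noteq> k \<Longrightarrow> y i = x i"
      by (auto simp: y_def)
    have "strict_pref (cyclic_profile A h k) (y k) (x k)"
      using y j k m less.prems props(1)
      by (subst strict_pref_cyclic) (auto simp: position_def m_def)
    moreover have "strict_pref (cyclic_profile A h j) (y j) (x j)"
      using y j k m jk props(1)
      by (subst strict_pref_cyclic) (auto simp: position_def m_def)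
    moreover have "pref (cyclic_profile A h i) (x i) (x i)" if "i \<in> {1..n}" for i
      using that props(1) by (subst pref_cyclic) auto
    ultimately have "\<forall>i\<in>{1..n}. pref (cyclic_profile A h i) (y i) (x i)"
      using y by (metis strict_pref_def)
    moreover have "allocation A y"
      unfolding y_def using al j k agents_A by (intro allocation_transpose) simp_all
    ultimately show False
      using x k \<open>strict_pref (cyclic_profile A h k) (y k) (x k)\<close>
      unfolding pareto_efficient_def agents_A by blast
  qed
qed

text \<open>The sum of the item indices is the same for all allocations. In a Pareto improvement,
  agents from 5 on keep their favourite, while agents 1 to 4, who rank by index, can only move to
  smaller indices; one strict gain would lower the sum.\<close>

private lemma pareto_efficientI:
  assumes x: "allocation A x" and fixed: "\<And>k. 5 \<le> k \<Longrightarrow> k \<le> n \<Longrightarrow> h (x k) = k"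
  shows "pareto_efficient A (cyclic_profile A h) x"
  unfolding pareto_efficient_def agents_A
proof (intro conjI notI x; (elim exE conjE)?)
  fix y assume y: "allocation A y" "\<forall>i\<in>{1..n}. pref (cyclic_profile A h i) (y i) (x i)"
    "\<exists>i\<in>{1..n}. strict_pref (cyclic_profile A h i) (y i) (x i)"
  note px = allocation_props[OF x] and py = allocation_props[OF y(1)]
  have pos: "position i (h (y i)) \<le> position i (h (x i))" if "i \<in> {1..n}" for i
    using y(2) that pref_cyclic[of i "y i" "x i"] px(1) py(1) by auto
  have le: "h (y i) \<le> h (x i)" if "i \<in> {1..n}" for i
  proof (cases "i \<le> 4")
    case True
    then show ?thesis using pos[OF that] by (simp add: position_def)
  next
    case False
    then have "h (x i) = i" using fixed[of i] that by simp
    then show ?thesis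
      using pos[OF that] False py(2)[OF that] by (auto simp: position_def split: if_splits)
  qed
  obtain i where i: "i \<in> {1..n}" "strict_pref (cyclic_profile A h i) (y i) (x i)"
    using y(3) by blast
  then have "h (y i) \<noteq> h (x i)"
    using strict_pref_cyclic[of i "y i" "x i"] px(1) py(1) by auto
  then have "\<exists>i\<in>{1..n}. h (y i) < h (x i)" using le i(1) order.not_eq_order_implies_strict by blast
  then have "(\<Sum>i\<in>{1..n}. h (y i)) < (\<Sum>i\<in>{1..n}. h (x i))"
    using le by (intro sum_strict_mono_ex1) auto
  then show False using px(5) py(5) by simp
qed

lemma no_intensity_efficient_cyclic: "\<not> intensity_efficient A (cyclic_profile A h) x"
proof
  let ?R = "cyclic_profile A h"
  assume eff: "intensity_efficient A ?R x"
  then have par: "pareto_efficient A ?R x" by (simp add: intensity_efficient_def)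
  then have al: "allocation A x" by (simp add: pareto_efficient_def)
  note props = allocation_props[OF al]
  define m where "m = h (x 1)"
  have one: "1 \<in> {1..n}" using n by simp
  have m: "m \<in> {1, 2, 3, 4}"
  proof -
    have "m \<in> {1..n}" using props(2)[OF one] by (simp add: m_def)
    moreover have "\<not> 5 \<le> m"
      using pareto_efficient_fixes[OF par, of m] props(3)[OF one, of m] \<open>m \<in> {1..n}\<close>
      by (auto simp: m_def)
    ultimately show ?thesis by auto
  qed
  \<comment> \<open>\<open>t\<close> follows \<open>m\<close> in the cycle of improving swaps,
    chosen so that \<open>gap\<close> below holds for each of the four values of
    \<open>m\<close>.\<close>
  define t :: nat where "t = (if m = 1 then 2 else if m = 2 then 4 else if m = 4 then 3 else 1)"
  have t: "t \<in> {1..n}" "t \<le> 4" "t \<noteq> m" using m n by (auto simp: t_def)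
  obtain j where j: "j \<in> {1..n}" "h (x j) = t" using props(4)[OF t(1)] by blast
  \<comment> \<open>Agents from 5 on hold their own items, so the owner of item \<open>t\<close> is
    among 1 to 4. Thus trading with agent 1 preserves Pareto efficiency, and this owner ranks by
    index on the falling scale.\<close>
  have j4: "j \<le> 4" using pareto_efficient_fixes[OF par, of j] j t(2) by force
  have j1: "j \<noteq> 1" using j t(3) by (auto simp: m_def)
  define y where "y = x \<circ> transpose 1 j"
  have y: "y 1 = x j" "y j = x 1" "\<And>i. i \<noteq> 1 \<Longrightarrow> i \<noteq> j \<Longrightarrow> y i = x i"
    by (auto simp: y_def)
  have aly: "allocation A y"
    unfolding y_def using al j one agents_A by (intro allocation_transpose) simp_all
  have "pareto_efficient A ?R y"
    using aly pareto_efficient_fixes[OF par] y(3) j4 by (intro pareto_efficientI) auto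
  moreover have "intensity_dominates A ?R y x"
  proof -
    have xA: "x 1 \<in> A" "x j \<in> A" using props(1) one j by auto
    have gap: "signed_gap rising_scale t m > signed_gap falling_scale t m"
      using m by (auto simp: t_def signed_gap_def rising_scale_def falling_scale_def)
    \<comment> \<open>Domination inspects the trading pair in both orders. Reversing the order
      exchanges the agents and flips both signs, so \<open>gap\<close> settles both cases.\<close>
    have can: "canonical A (?R 1) (x j, x 1) = signed_gap rising_scale t m"
      "canonical A (?R j) (x j, x 1) = signed_gap falling_scale t m"
      "canonical A (?R 1) (x 1, x j) = - signed_gap rising_scale t m"
      "canonical A (?R j) (x 1, x j) = - signed_gap falling_scale t m"
      using canonical_cyclic[of 1] canonical_cyclic[of j] xA j j4 j1
        signed_gap_antisym[of rising_scale m t] signed_gap_antisym[of falling_scale m t]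
      by (simp_all add: agent_scale_def m_def)
    \<comment> \<open>Any other agent keeps its item, so by injectivity of \<open>x\<close> it
      cannot have exchanged with anybody.\<close>
    have only: "(i = 1 \<and> k = j) \<or> (i = j \<and> k = 1)"
      if "i \<in> {1..n}" "k \<in> {1..n}" "i \<noteq> k" "y i = x k" "y k = x i" for i k
      using that props(3) y j(1) one by metis
    show ?thesis
      unfolding intensity_dominates_def agents_A
    proof (intro conjI ballI impI)
      fix i k assume "i \<in> {1..n}" "k \<in> {1..n}" "i \<noteq> k \<and> (y i, y k) = (x k, x i)"
      then consider "i = 1" "k = j" | "i = j" "k = 1" using only[of i k] by auto
      then show "canonical A (?R k) (y i, y k) \<le> canonical A (?R i) (y i, y k)"
        by cases (use gap y can in auto)
    next
      show "\<exists>i\<in>{1..n}. \<exists>k\<in>{1..n}. i \<noteq> k \<and> (y i, y k) = (x k, x i) \<and>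
          canonical A (?R k) (y i, y k) < canonical A (?R i) (y i, y k)"
        by (intro bexI[of _ 1] bexI[of _ j]) (use gap y can one j j1 in auto)
    qed
  qed
  ultimately show False using eff unfolding intensity_efficient_def by blast
qed

end

theorem theorem1:
  shows "(\<forall>A :: 'a set. card A = 3 \<longrightarrow>
            (\<forall>R. strict_intensity_profile A R \<longrightarrow> (\<exists>x. intensity_efficient A R x))) \<and>
         (\<forall>n\<ge>4. \<forall>A :: 'a set. card A = n \<longrightarrow>
            (\<exists>R. strict_intensity_profile A R \<and> \<not> (\<exists>x. intensity_efficient A R x)))"
proof (intro conjI allI impI)
  fix A :: "'a set" and R
  assume "card A = 3" "strict_intensity_profile A R"
  then show "\<exists>x. intensity_efficient A R x" by (rule intensity_efficient_if_card_3)
next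
  fix n :: nat and A :: "'a set"
  assume n: "4 \<le> n" "card A = n"
  then have "finite A" by (intro card_ge_0_finite) simp
  then obtain h where "bij_betw h A {1..n}"
    using finite_same_card_bij[of A "{1..n}"] n by auto
  then show "\<exists>R. strict_intensity_profile A R \<and> \<not> (\<exists>x. intensity_efficient A R x)"
    using strict_intensity_profile_cyclic no_intensity_efficient_cyclic n by blast
qed

end
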